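(* If $G$ is a connected graph with maximum degree $\Delta(G)\geq 5$ and $S(G)$ is its subdivision graph, then $\chi''_a(S(G))=\Delta(S(G))+1$ (i.e. $S(G)$ is of AVD-Type 1).
   Context: All graphs are simple, finite, undirected. The subdivision graph $S(G)$ has vertex set $V(G)\cup\{w_{u,v}:\{u,v\}\in E(G)\}$ and edges $\{u,w_{u,v}\}$, $\{w_{u,v},v\}$ for each $\{u,v\}\in E(G)$. $\Delta(H)$ is the maximum degree. A proper total coloring $f$ colors vertices and edges so that adjacent vertices, adjacent edges, and incident vertex-edge pairs get different colors. The color class of a vertex $u$ is $C_H(u)=\{f(u)\}\cup\{f(\{u,v\}):\{u,v\}\in E(H)\}$. An AVD-total coloring is a proper total coloring with $C_H(u)\neq C_H(v)$ for every edge $\{u,v\}$; $\chi''_a(H)$ is the least number of colors in an AVD-total coloring of $H$. *)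

theory Defs
  imports Main
begin

text \<open>A graph is a vertex set with a set of edges; an edge is the two-element set of its ends.\<close>

record 'a ugraph =
  verts :: "'a set"
  edges :: "'a set set"

definition simple_graph :: "'a ugraph \<Rightarrow> bool" where
  "simple_graph G \<longleftrightarrow> finite (verts G) \<and>
     (\<forall>e\<in>edges G. \<exists>u\<in>verts G. \<exists>v\<in>verts G. u \<noteq> v \<and> e = {u, v})"

definition connected_graph :: "'a ugraph \<Rightarrow> bool" where
  "connected_graph G \<longleftrightarrow> verts G \<noteq> {} \<and>
     (\<forall>u\<in>verts G. \<forall>v\<in>verts G. (u, v) \<in> {(x, y). {x, y} \<in> edges G}\<^sup>*)"

definition degree :: "'a ugraph \<Rightarrow> 'a \<Rightarrow> nat" where
  "degree G u = card {e \<in> edges G. u \<in> e}"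

text \<open>Only meaningful when there are finitely many vertices and at least one.\<close>

definition max_degree :: "'a ugraph \<Rightarrow> nat" where
  "max_degree G = Max (degree G ` verts G)"

text \<open>The original vertex \<open>u\<close> becomes \<open>Inl u\<close>; the new vertex \<open>w\<^sub>u\<^sub>,\<^sub>v\<close> is \<open>Inr {u, v}\<close>.\<close>

definition subdivision :: "'a ugraph \<Rightarrow> ('a + 'a set) ugraph" where
  "subdivision G = \<lparr>verts = Inl ` verts G \<union> Inr ` edges G,
     edges = {{Inl u, Inr e} | u e. e \<in> edges G \<and> u \<in> e}\<rparr>"

lemma simple_graph_subdivision:
  assumes "simple_graph G"
  shows "simple_graph (subdivision G)"
proof -
  have "edges G \<subseteq> Pow (verts G)" and "finite (verts G)"
    using assms by (auto simp: simple_graph_def)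
  then have "finite (edges G)"
    by (meson finite_Pow_iff finite_subset)
  then show ?thesis
    using \<open>finite (verts G)\<close> \<open>edges G \<subseteq> Pow (verts G)\<close>
    by (fastforce simp: simple_graph_def subdivision_def)
qed

text \<open>A total coloring is a single function on vertices (\<open>Inl\<close>) and edges (\<open>Inr\<close>);
  its values on elements outside the graph are irrelevant.\<close>

definition proper_total_coloring :: "'a ugraph \<Rightarrow> ('a + 'a set \<Rightarrow> 'c) \<Rightarrow> bool" where
  "proper_total_coloring H f \<longleftrightarrow>
     (\<forall>u v. {u, v} \<in> edges H \<longrightarrow> f (Inl u) \<noteq> f (Inl v)) \<and>
     (\<forall>e\<in>edges H. \<forall>e'\<in>edges H. e \<noteq> e' \<and> e \<inter> e' \<noteq> {} \<longrightarrow> f (Inr e) \<noteq> f (Inr e')) \<and>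
     (\<forall>e\<in>edges H. \<forall>u\<in>e. f (Inl u) \<noteq> f (Inr e))"

definition color_class :: "'a ugraph \<Rightarrow> ('a + 'a set \<Rightarrow> 'c) \<Rightarrow> 'a \<Rightarrow> 'c set" where
  "color_class H f u = {f (Inl u)} \<union> {f (Inr {u, v}) | v. {u, v} \<in> edges H}"

definition avd_total_coloring :: "'a ugraph \<Rightarrow> ('a + 'a set \<Rightarrow> 'c) \<Rightarrow> bool" where
  "avd_total_coloring H f \<longleftrightarrow> proper_total_coloring H f \<and>
     (\<forall>u v. {u, v} \<in> edges H \<longrightarrow> color_class H f u \<noteq> color_class H f v)"

definition avd_total_chromatic_number :: "'a ugraph \<Rightarrow> nat" where
  "avd_total_chromatic_number H = (LEAST k. \<exists>f :: 'a + 'a set \<Rightarrow> nat.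
     avd_total_coloring H f \<and> f ` (Inl ` verts H \<union> Inr ` edges H) \<subseteq> {..<k})"

end

theory Submission
  imports Defs "HOL-Combinatorics.Transposition"
begin

text \<open>A total coloring of \<open>S(G)\<close> with \<open>\<Delta> + 1\<close> colors arises from a proper edge coloring of the
  bipartite graph \<open>S(G)\<close> with \<open>\<Delta>\<close> colors, which exists by Koenig's theorem: color all original
  vertices with the extra color, and every subdivision vertex with one of the \<open>\<Delta>\<close> colors that is
  missing at its two edges. The extra color lies in the class of every original vertex and in the
  class of no subdivision vertex, so adjacent vertices are distinguished.\<close>

section \<open>Koenig's edge coloring theorem\<close>

text \<open>A bipartite graph is encoded as its set of pairs of left and right end, so bipartiteness
  is built into the types.\<close>

definition proper_edge_coloring :: "('a \<times> 'b) set \<Rightarrow> ('a \<times> 'b \<Rightarrow> 'c) \<Rightarrow> bool" where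
  "proper_edge_coloring E c \<longleftrightarrow>
     (\<forall>x y y'. (x, y) \<in> E \<longrightarrow> (x, y') \<in> E \<longrightarrow> y \<noteq> y' \<longrightarrow> c (x, y) \<noteq> c (x, y')) \<and>
     (\<forall>x x' y. (x, y) \<in> E \<longrightarrow> (x', y) \<in> E \<longrightarrow> x \<noteq> x' \<longrightarrow> c (x, y) \<noteq> c (x', y))"

lemma missing_color:
  fixes g :: "'a \<Rightarrow> nat"
  assumes "finite A" "card A < k"
  obtains a where "a < k" "a \<notin> g ` A"
proof -
  have "card (g ` A) < card {..<k}"
    using card_image_le[OF assms(1), of g] assms(2) by simp
  then have "\<not> {..<k} \<subseteq> g ` A"
    using assms(1) by (meson card_mono finite_imageI not_le)
  then show ?thesis using that by auto
qed

text \<open>\<open>R\<close> is the part, on the side of \<open>u\<close>, of the component of \<open>u\<close> in the subgraph of the edges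
  colored \<open>a\<close> or \<open>b\<close>. Following the \<open>b\<close>-edges from left to right and the \<open>a\<close>-edges back already
  reaches all of it, because \<open>u\<close> misses \<open>a\<close>; hence \<open>w\<close>, which misses \<open>b\<close>, is not reached, and
  exchanging \<open>a\<close> and \<open>b\<close> in the component frees \<open>b\<close> at both \<open>u\<close> and \<open>w\<close>.\<close>

lemma Kempe_extension:
  fixes c :: "'a \<times> 'b \<Rightarrow> 'c"
  assumes c: "proper_edge_coloring E c"
    and new: "(u, w) \<notin> E"
    and a: "\<And>y. (u, y) \<in> E \<Longrightarrow> c (u, y) \<noteq> a"
    and b: "\<And>x. (x, w) \<in> E \<Longrightarrow> c (x, w) \<noteq> b"
  obtains c' where "proper_edge_coloring (insert (u, w) E) c'"
    and "c' ` insert (u, w) E \<subseteq> c ` E \<union> {a, b}"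
proof -
  have cx: "y = y'" if "(x, y) \<in> E" "(x, y') \<in> E" "c (x, y) = c (x, y')" for x y y'
    using c that by (auto simp: proper_edge_coloring_def)
  have cy: "x = x'" if "(x, y) \<in> E" "(x', y) \<in> E" "c (x, y) = c (x', y)" for x x' y
    using c that unfolding proper_edge_coloring_def by metis
  define S where
    "S = {(x, x'). \<exists>y. (x, y) \<in> E \<and> (x', y) \<in> E \<and> c (x, y) = b \<and> c (x', y) = a}"
  define R where "R = S\<^sup>* `` {u}"
  have uR: "u \<in> R" by (simp add: R_def)
  have step: "x' \<in> R" if "x \<in> R" "(x, y) \<in> E" "(x', y) \<in> E" "c (x, y) = b" "c (x', y) = a"
    for x x' y
    using that unfolding R_def S_def by (auto intro: rtrancl_into_rtrancl)
  \<comment> \<open>Since \<open>u\<close> misses \<open>a\<close>, \<open>x\<close> is not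
    \<open>u\<close>, so the last \<open>S\<close>-step into \<open>x\<close> came along an
    \<open>a\<close>-edge. Only one \<open>a\<close>-edge leaves \<open>x\<close>, so that step
    passed through \<open>y\<close>.\<close>
  have b_pred: "\<exists>x0\<in>R. (x0, y) \<in> E \<and> c (x0, y) = b"
    if x: "x \<in> R" "(x, y) \<in> E" "c (x, y) = a" for x y
  proof -
    have "(u, x) \<in> S\<^sup>*" "x \<noteq> u" using x a by (auto simp: R_def)
    then obtain x0 where "x0 \<in> R" "(x0, x) \<in> S"
      unfolding R_def by (metis Image_singleton_iff rtranclE)
    moreover from this(2) obtain y0 where "(x0, y0) \<in> E" "(x, y0) \<in> E"
      "c (x0, y0) = b" "c (x, y0) = a"
      by (auto simp: S_def)
    ultimately show ?thesis using cx[of x y0 y] x by auto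
  qed
  \<comment> \<open>The left end alone decides whether an edge is subject to the exchange;
    \<open>transpose\<close> fixes all colors but \<open>a\<close> and \<open>b\<close>.\<close>
  define c' where "c' = (\<lambda>(x, y). if (x, y) = (u, w) then b
     else if x \<in> R then transpose a b (c (x, y)) else c (x, y))"
  have c'_new: "c' (u, w) = b" by (simp add: c'_def)
  have c'_in: "c' (x, y) = transpose a b (c (x, y))" if "(x, y) \<in> E" "x \<in> R" for x y
    using that new by (auto simp: c'_def)
  have c'_out: "c' (x, y) = c (x, y)" if "(x, y) \<in> E" "x \<notin> R" for x y
    using that new by (auto simp: c'_def)
  have inj: "transpose a b p = transpose a b q \<longleftrightarrow> p = q" for p q
    by (metis transpose_involutory)
  have to_b: "transpose a b p = b \<longleftrightarrow> p = a" for p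
    by (metis transpose_apply_first inj)
  have left: "c' (x, y) \<noteq> c' (x, y')" if "(x, y) \<in> E" "(x, y') \<in> E" "y \<noteq> y'" for x y y'
    using cx[OF that(1,2)] that by (cases "x \<in> R") (auto simp: c'_in c'_out inj)
  have new_left: "c' (u, y) \<noteq> b" if "(u, y) \<in> E" for y
    using that a uR by (simp add: c'_in to_b)
  \<comment> \<open>An \<open>a\<close>-edge from \<open>R\<close> to \<open>w\<close> would, by
    \<open>b_pred\<close>, come with a \<open>b\<close>-edge at \<open>w\<close>, but
    \<open>w\<close> misses \<open>b\<close>.\<close>
  have new_right: "c' (x, w) \<noteq> b" if "(x, w) \<in> E" for x
  proof (cases "x \<in> R")
    case True
    then show ?thesis using that b b_pred[of x w] by (auto simp: c'_in to_b)
  next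
    case False
    then show ?thesis using that b by (simp add: c'_out)
  qed
  \<comment> \<open>If \<open>(x, y)\<close> has color \<open>a\<close> or \<open>b\<close>, then an
    edge at \<open>y\<close> of the other color also starts in \<open>R\<close>, by
    \<open>b_pred\<close> or \<open>step\<close>, so it cannot come from \<open>x'\<close>. Any
    other color is fixed by the exchange.\<close>
  have mixed: "c' (x, y) \<noteq> c' (x', y)"
    if "(x, y) \<in> E" "(x', y) \<in> E" "x \<in> R" "x' \<notin> R" for x x' y
  proof
    assume "c' (x, y) = c' (x', y)"
    then have eq: "transpose a b (c (x, y)) = c (x', y)" using that by (simp add: c'_in c'_out)
    consider "c (x, y) = a" | "c (x, y) = b" | "c (x, y) \<noteq> a" "c (x, y) \<noteq> b" by blast
    then show False
    proof cases
      case 1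
      then show ?thesis using eq b_pred[of x y] that cy[of _ y x'] by auto
    next
      case 2
      then show ?thesis using eq step[of x y x'] that by auto
    next
      case 3
      then show ?thesis using eq cy[of x y x'] that by auto
    qed
  qed
  have right: "c' (x, y) \<noteq> c' (x', y)" if "(x, y) \<in> E" "(x', y) \<in> E" "x \<noteq> x'" for x x' y
  proof (cases "x \<in> R \<longleftrightarrow> x' \<in> R")
    case True
    then show ?thesis
      using cy[OF that(1,2)] that by (cases "x \<in> R") (auto simp: c'_in c'_out inj)
  next
    case False
    then show ?thesis using mixed[of x y x'] mixed[of x' y x] that by fastforce
  qed
  have "proper_edge_coloring (insert (u, w) E) c'"
    unfolding proper_edge_coloring_def
    using left right new_left new_right c'_new
    by (auto dest: not_sym simp: eq_commute[of b])
  moreover have "c' p \<in> {c p, a, b}" for p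
    by (cases p) (simp add: c'_def transpose_def)
  then have "c' ` insert (u, w) E \<subseteq> c ` E \<union> {a, b}"
    using c'_new by blast
  ultimately show ?thesis using that by blast
qed

text \<open>Induction on the edges: once the rest is colored, each end of the added edge still has a
  free color, and \<open>Kempe_extension\<close> makes one color free at both.\<close>

theorem Koenig_edge_coloring:
  fixes E :: "('a \<times> 'b) set" and k :: nat
  assumes "finite E"
    and "\<And>x. card {y. (x, y) \<in> E} \<le> k"
    and "\<And>y. card {x. (x, y) \<in> E} \<le> k"
  obtains c where "proper_edge_coloring E c" "c ` E \<subseteq> {..<k}"
proof -
  have "\<exists>c. proper_edge_coloring E c \<and> c ` E \<subseteq> {..<k}"
    using assms
  proof (induction E)
    case empty
    then show ?case by (simp add: proper_edge_coloring_def)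
  next
    case (insert e E)
    obtain u w where e: "e = (u, w)" by fastforce
    have fin_left: "finite {y. (x, y) \<in> E}" for x
      using finite_subset[of "{y. (x, y) \<in> E}" "snd ` E"] insert.hyps(1) by force
    have fin_right: "finite {x. (x, y) \<in> E}" for y
      using finite_subset[of "{x. (x, y) \<in> E}" "fst ` E"] insert.hyps(1) by force
    have ins_left: "{y. (x, y) \<in> insert e E} = (if x = u then {w} else {}) \<union> {y. (x, y) \<in> E}" for x
      by (auto simp: e)
    have ins_right: "{x. (x, y) \<in> insert e E} = (if y = w then {u} else {}) \<union> {x. (x, y) \<in> E}" for y
      by (auto simp: e)
    have "card {y. (x, y) \<in> E} \<le> k" for x
    proof (rule order.trans[OF card_mono insert.prems(1)[of x]])
      show "finite {y. (x, y) \<in> insert e E}" unfolding ins_left using fin_left by simp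
    qed auto
    moreover have "card {x. (x, y) \<in> E} \<le> k" for y
    proof (rule order.trans[OF card_mono insert.prems(2)[of y]])
      show "finite {x. (x, y) \<in> insert e E}" unfolding ins_right using fin_right by simp
    qed auto
    ultimately obtain c where c: "proper_edge_coloring E c" "c ` E \<subseteq> {..<k}"
      using insert.IH by blast
    \<comment> \<open>The edge \<open>e\<close> itself counts towards the bound \<open>k\<close> at
      \<open>u\<close>, which makes the bound for \<open>E\<close> strict.\<close>
    have "card {y. (u, y) \<in> E} < k"
      using insert.prems(1)[of u] fin_left[of u] insert.hyps(2)
      by (simp add: ins_left[unfolded e] e card_insert_if del: insert_iff)
    then obtain a where a: "a < k" "a \<notin> (\<lambda>y. c (u, y)) ` {y. (u, y) \<in> E}"
      by (rule missing_color[OF fin_left])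
    have "card {x. (x, w) \<in> E} < k"
      using insert.prems(2)[of w] fin_right[of w] insert.hyps(2)
      by (simp add: ins_right[unfolded e] e card_insert_if del: insert_iff)
    then obtain b where b: "b < k" "b \<notin> (\<lambda>x. c (x, w)) ` {x. (x, w) \<in> E}"
      by (rule missing_color[OF fin_right])
    \<comment> \<open>The colors \<open>a\<close> and \<open>b\<close> may coincide; the exchange is
      then the identity.\<close>
    obtain c' where "proper_edge_coloring (insert e E) c'" "c' ` insert e E \<subseteq> c ` E \<union> {a, b}"
      using Kempe_extension[OF c(1), of u w a b thesis] insert.hyps(2) a(2) b(2)
      unfolding e by blast
    then show ?case using c(2) a(1) b(1) by blast
  qed
  then show ?thesis using that by blast
qed

section \<open>Total colorings of subdivision graphs\<close>

lemma finite_edges: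
  assumes "simple_graph G"
  shows "finite (edges G)"
proof -
  have "edges G \<subseteq> Pow (verts G)" using assms by (auto simp: simple_graph_def)
  then show ?thesis
    using assms by (meson finite_Pow_iff finite_subset simple_graph_def)
qed

lemma card_edge:
  assumes "simple_graph G" "e \<in> edges G"
  shows "card e = 2"
  using assms by (auto simp: simple_graph_def)

text \<open>A vertex and its incident edges all get different colors. At a vertex of maximum degree
  this is the lower bound.\<close>

lemma degree_less_colors:
  fixes f :: "'a + 'a set \<Rightarrow> nat"
  assumes "simple_graph H" "u \<in> verts H" "proper_total_coloring H f"
    and "f ` (Inl ` verts H \<union> Inr ` edges H) \<subseteq> {..<k}"
  shows "degree H u < k"
proof -
  let ?I = "{e \<in> edges H. u \<in> e}"
  let ?A = "insert (Inl u) (Inr ` ?I)"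
  have "inj_on f ?A"
    using assms(3) unfolding proper_total_coloring_def inj_on_def by (auto; metis disjoint_iff)
  then have "card (f ` ?A) = Suc (degree H u)"
    using finite_edges[OF assms(1)]
    by (subst card_image) (auto simp: degree_def card_image card_insert_if)
  moreover have "f ` ?A \<subseteq> {..<k}" using assms(2,4) by auto
  ultimately show ?thesis
    using card_mono[of "{..<k}" "f ` ?A"] by simp
qed

lemma mem_edges_subdivision:
  "{Inl u, Inr e} \<in> edges (subdivision G) \<longleftrightarrow> e \<in> edges G \<and> u \<in> e"
  by (auto simp: subdivision_def doubleton_eq_iff)

lemma edges_subdivisionE:
  assumes "{x, y} \<in> edges (subdivision G)"
  obtains (Inl_Inr) u e where "x = Inl u" "y = Inr e" "e \<in> edges G" "u \<in> e"
    | (Inr_Inl) u e where "x = Inr e" "y = Inl u" "e \<in> edges G" "u \<in> e"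
  using assms by (auto simp: subdivision_def doubleton_eq_iff)

lemma degree_subdivision_Inl:
  fixes G :: "'a ugraph"
  shows "degree (subdivision G) (Inl u) = degree G u"
proof -
  have "{d \<in> edges (subdivision G). Inl u \<in> d} = (\<lambda>e. {Inl u, Inr e}) ` {e \<in> edges G. u \<in> e}"
    by (auto simp: subdivision_def)
  moreover have "inj (\<lambda>e. {Inl u, Inr e :: 'a + 'a set})"
    by (auto simp: inj_def doubleton_eq_iff)
  ultimately show ?thesis
    by (simp add: degree_def card_image inj_on_subset[OF _ subset_UNIV])
qed

lemma degree_subdivision_Inr:
  fixes G :: "'a ugraph"
  assumes "e \<in> edges G"
  shows "degree (subdivision G) (Inr e) = card e"
proof -
  have "{d \<in> edges (subdivision G). Inr e \<in> d} = (\<lambda>u. {Inl u, Inr e}) ` e"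
    using assms by (auto simp: subdivision_def)
  moreover have "inj (\<lambda>u. {Inl u, Inr e :: 'a + 'a set})"
    by (auto simp: inj_def doubleton_eq_iff)
  ultimately show ?thesis
    by (simp add: degree_def card_image inj_on_subset[OF _ subset_UNIV])
qed

text \<open>Original vertices keep their degrees and new ones have degree 2, which cannot exceed a
  maximum that is already at least 2.\<close>

lemma max_degree_subdivision:
  assumes "simple_graph G" "verts G \<noteq> {}" "max_degree G \<ge> 2"
  shows "max_degree (subdivision G) = max_degree G"
proof -
  let ?D = "degree G ` verts G"
  have fin: "finite ?D" "?D \<noteq> {}" using assms(1,2) by (auto simp: simple_graph_def)
  have "degree (subdivision G) ` verts (subdivision G) = ?D \<union> (\<lambda>_. 2) ` edges G"
    using assms(1)
    by (simp add: subdivision_def[of G, THEN arg_cong[where f = verts]] image_Un image_image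
        degree_subdivision_Inl degree_subdivision_Inr card_edge)
  moreover have "Max (?D \<union> (\<lambda>_. 2) ` edges G) = Max ?D"
    using fin assms(3) finite_edges[OF assms(1)]
    by (intro Max_eqI) (auto simp: max_degree_def intro: Max_in[THEN subsetD[OF Un_upper1]])
  ultimately show ?thesis by (simp add: max_degree_def)
qed

text \<open>Color \<open>k\<close> is the extra one. A subdivision vertex must avoid the colors of
  its two edges among those below \<open>k\<close>, hence \<open>k \<ge> 3\<close>.\<close>

lemma subdivision_avd_total_coloring:
  fixes G :: "'a ugraph"
  assumes "simple_graph G" "\<And>u. degree G u \<le> k" "k \<ge> 3"
  obtains f :: "('a + 'a set) + ('a + 'a set) set \<Rightarrow> nat"
  where "avd_total_coloring (subdivision G) f" "range f \<subseteq> {..k}"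
proof -
  \<comment> \<open>The incidence relation of \<open>G\<close> is S(G) as a bipartite graph, with
    original vertices on the left and subdivision vertices on the right.\<close>
  let ?E = "{(u, e). e \<in> edges G \<and> u \<in> e}"
  have "?E \<subseteq> \<Union> (edges G) \<times> edges G" by auto
  moreover have fin_edge: "finite e" if "e \<in> edges G" for e
    using card_edge[OF assms(1) that] by (metis card.infinite zero_neq_numeral)
  ultimately have "finite ?E"
    using finite_edges[OF assms(1)] by (meson finite_SigmaI finite_Union finite_subset)
  moreover have "card {e. (u, e) \<in> ?E} \<le> k" for u
    using assms(2)[of u] by (simp add: degree_def)
  moreover have "card {u. (u, e) \<in> ?E} \<le> k" for e
    using card_edge[OF assms(1), of e] assms(3) by (cases "e \<in> edges G") auto
  ultimately obtain c where c: "proper_edge_coloring ?E c" "c ` ?E \<subseteq> {..<k}"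
    by (rule Koenig_edge_coloring)
  have "\<exists>a<k. a \<notin> (\<lambda>u. c (u, e)) ` e" if "e \<in> edges G" for e
    using missing_color[OF fin_edge[OF that], of k "\<lambda>u. c (u, e)"] card_edge[OF assms(1) that]
      assms(3) by auto
  then obtain w where w: "\<And>e. e \<in> edges G \<Longrightarrow> w e < k"
    "\<And>e u. e \<in> edges G \<Longrightarrow> u \<in> e \<Longrightarrow> w e \<noteq> c (u, e)"
    by (metis image_eqI)
  have c_less: "c (u, e) < k" if "e \<in> edges G" "u \<in> e" for u e
    using c(2) that by auto
  \<comment> \<open>\<open>c\<close> colors pairs, whereas edges of the subdivision are two-element
    sets; \<open>ends\<close> recovers the pair.\<close>
  define ends :: "('a + 'a set) set \<Rightarrow> 'a \<times> 'a set"
    where "ends d = (THE p. d = {Inl (fst p), Inr (snd p)})" for d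
  have ends: "ends {Inl u, Inr e} = (u, e)" for u e
    unfolding ends_def by (rule the_equality) (auto simp: doubleton_eq_iff)
  \<comment> \<open>The minimum with \<open>k\<close> only affects values outside the graph.\<close>
  define f :: "('a + 'a set) + ('a + 'a set) set \<Rightarrow> nat"
    where "f = case_sum (case_sum (\<lambda>_. k) (\<lambda>e. min k (w e))) (\<lambda>d. min k (c (ends d)))"
  have f_Inl: "f (Inl (Inl u)) = k" for u by (simp add: f_def)
  have f_Inr: "f (Inl (Inr e)) = w e" if "e \<in> edges G" for e
    using w(1)[OF that] by (simp add: f_def)
  have f_edge: "f (Inr {Inl u, Inr e}) = c (u, e)" "f (Inr {Inr e, Inl u}) = c (u, e)"
    if "e \<in> edges G" "u \<in> e" for u e
    using c_less[OF that] by (simp_all add: f_def ends insert_commute)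
  note f_simps = f_Inl f_Inr f_edge
  have vertex: "f (Inl x) \<noteq> f (Inl y)" if "{x, y} \<in> edges (subdivision G)" for x y
    using that by (cases rule: edges_subdivisionE) (use w(1) in \<open>force simp: f_simps\<close>)+
  have edge: "f (Inr d) \<noteq> f (Inr d')"
    if dd': "d \<in> edges (subdivision G)" "d' \<in> edges (subdivision G)"
      and meet: "d \<noteq> d'" "d \<inter> d' \<noteq> {}" for d d'
  proof -
    obtain u e where d: "d = {Inl u, Inr e}" "e \<in> edges G" "u \<in> e"
      using dd'(1) by (auto simp: subdivision_def)
    obtain u' e' where d': "d' = {Inl u', Inr e'}" "e' \<in> edges G" "u' \<in> e'"
      using dd'(2) by (auto simp: subdivision_def)
    \<comment> \<open>Distinct edges that meet share exactly one end; the two cases match the two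
      conjuncts of \<open>proper_edge_coloring\<close>.\<close>
    have "(u = u' \<and> e \<noteq> e') \<or> (u \<noteq> u' \<and> e = e')"
      using meet d(1) d'(1) by auto
    then show ?thesis
      using c(1) d d' by (auto simp: f_simps proper_edge_coloring_def)
  qed
  have incident: "f (Inl x) \<noteq> f (Inr d)" if d_edge: "d \<in> edges (subdivision G)" and x: "x \<in> d" for x d
  proof -
    obtain u e where d: "d = {Inl u, Inr e}" "e \<in> edges G" "u \<in> e"
      using d_edge by (auto simp: subdivision_def)
    then show ?thesis
      using x w(2)[OF d(2,3)] c_less[OF d(2,3)] by (auto simp: f_simps)
  qed
  have class_Inl: "k \<in> color_class (subdivision G) f (Inl u)" for u
    by (simp add: color_class_def f_Inl)
  have class_Inr: "k \<notin> color_class (subdivision G) f (Inr e)" if "e \<in> edges G" for e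
  proof -
    have "f (Inr {Inr e, y}) \<noteq> k" if "{Inr e, y} \<in> edges (subdivision G)" for y
      using that by (cases rule: edges_subdivisionE) (use c_less in \<open>force simp: f_simps\<close>)+
    then show ?thesis
      using w(1)[OF that] by (auto simp: color_class_def f_Inr[OF that])
  qed
  have "color_class (subdivision G) f x \<noteq> color_class (subdivision G) f y"
    if "{x, y} \<in> edges (subdivision G)" for x y
    using that by (cases rule: edges_subdivisionE) (use class_Inl class_Inr in blast)+
  then have "avd_total_coloring (subdivision G) f"
    using vertex edge incident by (simp add: avd_total_coloring_def proper_total_coloring_def)
  moreover have "range f \<subseteq> {..k}" by (auto simp: f_def split: sum.splits)
  ultimately show ?thesis using that by blast
qed

theorem theorem5p3:
  fixes G :: "'a ugraph"
  assumes "simple_graph G"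
    and "connected_graph G"
    and "max_degree G \<ge> 5"
  shows "avd_total_chromatic_number (subdivision G) = max_degree (subdivision G) + 1"
proof -
  have ne: "verts G \<noteq> {}" using assms(2) by (simp add: connected_graph_def)
  have fin: "finite (verts G)" using assms(1) by (simp add: simple_graph_def)
  have max: "max_degree (subdivision G) = max_degree G"
    using max_degree_subdivision[OF assms(1) ne] assms(3) by simp
  \<comment> \<open>The coloring lemma asks for a degree bound on the whole type; outside
    \<open>verts G\<close> the degree is 0.\<close>
  have "degree G u \<le> max_degree G" for u
  proof (cases "u \<in> verts G")
    case True
    then show ?thesis using fin by (simp add: max_degree_def)
  next
    case False
    then have "{e \<in> edges G. u \<in> e} = {}" using assms(1) by (auto simp: simple_graph_def)
    then show ?thesis unfolding degree_def by (simp only: card.empty)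
  qed
  then obtain f :: "('a + 'a set) + ('a + 'a set) set \<Rightarrow> nat"
    where f: "avd_total_coloring (subdivision G) f" "range f \<subseteq> {..max_degree G}"
    using subdivision_avd_total_coloring[OF assms(1), of "max_degree G"] assms(3) by auto
  \<comment> \<open>A vertex attaining the maximum keeps its degree in the subdivision and so forces
    \<open>max_degree G + 1\<close> colors.\<close>
  have "max_degree G \<in> degree G ` verts G"
    using fin ne unfolding max_degree_def by (intro Max_in) auto
  then obtain u where u: "u \<in> verts G" "degree G u = max_degree G" by auto
  have "Inl u \<in> verts (subdivision G)" using u(1) by (simp add: subdivision_def)
  note lower = degree_less_colors[OF simple_graph_subdivision[OF assms(1)] this]
  show ?thesis
    unfolding avd_total_chromatic_number_def max
  proof (rule Least_equality)
    show "\<exists>f :: ('a + 'a set) + ('a + 'a set) set \<Rightarrow> nat. avd_total_coloring (subdivision G) f \<and>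
        f ` (Inl ` verts (subdivision G) \<union> Inr ` edges (subdivision G)) \<subseteq> {..<max_degree G + 1}"
      using f by (intro exI[of _ f]) (auto simp: less_Suc_eq_le image_subset_iff)
  next
    fix k
    assume "\<exists>f :: ('a + 'a set) + ('a + 'a set) set \<Rightarrow> nat. avd_total_coloring (subdivision G) f \<and>
        f ` (Inl ` verts (subdivision G) \<union> Inr ` edges (subdivision G)) \<subseteq> {..<k}"
    then show "max_degree G + 1 \<le> k"
      using lower by (auto simp: avd_total_coloring_def degree_subdivision_Inl u(2) Suc_le_eq)
  qed
qed

end
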